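(* Let $0<q\le 1$, $0\le\theta\le 1$, and let $n,k$ be integers with $1\le k\le n$. Let $X_1,\dots,X_n$ be a $q$-sequence of binary trials with parameters $(\theta,q)$ and let $E_{n,k}$ be the number of success runs of length exactly $k$ in $X_1,\dots,X_n$. Then for every integer $x\ge 0$, $$P_{q,\theta}(E_{n,k}=x)=\sum_{i=0}^{n-xk}\theta^{n-i}\Big(\prod_{j=1}^{i}(1-\theta q^{j-1})\Big)B_q(i+1,\,n-i,\,x,\,k).$$
   Context: A $q$-sequence of binary trials with parameters $(\theta,q)$ is a sequence of $\{0,1\}$-valued random variables $X_1,X_2,\dots$ ($1$ = success, $0$ = failure) such that, conditionally on $X_1,\dots,X_{j-1}$, the probability that $X_j=1$ is $\theta q^{z}$, where $z=\sum_{m=1}^{j-1}(1-X_m)$ is the number of failures among the first $j-1$ trials (so the probability that $X_j=0$ is $1-\theta q^{z}$). For $q=1$ these are i.i.d. Bernoulli trials with success probability $\theta$. $P_{q,\theta}$ denotes probability under this model. A success run of length exactly $k$ is a block of $k$ consecutive ones that is preceded by a zero or by the beginning of the sequence and followed by a zero or by the end of the sequence (i.e. a maximal block of ones having length exactly $k$). $E_{n,k}$ counts these in $X_1,\dots,X_n$. For integers $r\ge1$, $k\ge 1$ and integers $s,t$, define $$B_q(r,s,t,k)=\sum q^{\,y_2+2y_3+\cdots+(r-1)y_r},$$ where the sum is over all tuples $(y_1,\dots,y_r)$ of nonnegative integers with $y_1+\cdots+y_r=s$ and with exactly $t$ of the indices $i$ satisfying $y_i=k$ (an empty sum is $0$).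 Conventions: empty products are $1$, sums with upper limit smaller than the lower limit are $0$, and $0^0=1$. *)

theory Defs
  imports "HOL-Probability.Probability"
begin

text \<open>
  The trials are numbered from 1, and only \<open>X 1, \<dots>, X n\<close> are constrained: an infinite
  q-sequence is one for every \<open>n\<close>. Since the trials are discrete, conditioning on the first
  \<open>j - 1\<close> of them means conditioning on each history \<open>x\<close> of positive probability. Such a
  history takes values in \<open>{0, 1}\<close>, so the subtraction on \<open>nat\<close> below does not truncate.
\<close>

definition q_sequence ::
    "'a measure \<Rightarrow> (nat \<Rightarrow> 'a \<Rightarrow> nat) \<Rightarrow> nat \<Rightarrow> real \<Rightarrow> real \<Rightarrow> bool" where
  "q_sequence M X n \<theta> q \<longleftrightarrow>
     prob_space M \<and>
     (\<forall>j\<in>{1..n}. X j \<in> measurable M (count_space {0, 1})) \<and>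
     (\<forall>j\<in>{1..n}. \<forall>x.
        \<P>(\<omega> in M. \<forall>m\<in>{1..<j}. X m \<omega> = x m) > 0 \<longrightarrow>
        \<P>(\<omega> in M. X j \<omega> = 1 \<bar> \<forall>m\<in>{1..<j}. X m \<omega> = x m) =
          \<theta> * q ^ (\<Sum>m\<in>{1..<j}. 1 - x m))"

text \<open>
  A run is identified with its starting position \<open>a\<close>; it occupies the positions
  \<open>a, \<dots>, a + k - 1\<close>.
\<close>

definition exact_success_runs :: "nat \<Rightarrow> nat \<Rightarrow> (nat \<Rightarrow> nat) \<Rightarrow> nat" where
  "exact_success_runs n k x =
     card {a. 1 \<le> a \<and> a + k \<le> n + 1 \<and>
              (\<forall>j\<in>{a..<a + k}. x j = 1) \<and>
              (a = 1 \<or> x (a - 1) = 0) \<and>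
              (a + k = n + 1 \<or> x (a + k) = 0)}"

text \<open>
  The tuple \<open>(y\<^sub>1, \<dots>, y\<^sub>r)\<close> is a list of length \<open>r\<close> with \<open>y\<^sub>i = y ! (i - 1)\<close>, which turns the
  exponent \<open>y\<^sub>2 + 2 y\<^sub>3 + \<cdots> + (r - 1) y\<^sub>r\<close> into \<open>\<Sum>i<r. i * y ! i\<close>.
\<close>

definition Bq :: "real \<Rightarrow> nat \<Rightarrow> int \<Rightarrow> int \<Rightarrow> nat \<Rightarrow> real" where
  "Bq q r s t k =
     (\<Sum>y\<in>{y :: nat list. length y = r \<and> int (sum_list y) = s \<and>
                         int (card {i. i < r \<and> y ! i = k}) = t}.
        q ^ (\<Sum>i<r. i * y ! i))"

end

theory Submission
  imports Defs
begin

text \<open>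
  A binary word with \<open>i\<close> zeros is determined by the lengths \<open>y\<^sub>1, \<dots>, y\<^sub>i\<^sub>+\<^sub>1\<close> of the (possibly empty)
  blocks of ones that the zeros separate. The ones of the block \<open>y\<^sub>m\<close> each contribute
  \<open>\<theta> q\<^bsup>m - 1\<^esup>\<close> to the probability of the word and the \<open>m\<close>-th zero contributes
  \<open>1 - \<theta> q\<^bsup>m - 1\<^esup>\<close>. As \<open>k \<ge> 1\<close>, the runs of length exactly \<open>k\<close> are the blocks with
  \<open>y\<^sub>m = k\<close>. Summing over the words by their number of zeros gives the formula.
\<close>

section \<open>Binary words and their block lengths\<close>

fun word_of_blocks :: "nat list \<Rightarrow> bool list" where
  "word_of_blocks [] = []"
| "word_of_blocks [a] = replicate a True"
| "word_of_blocks (a # b # ys) = replicate a True @ False # word_of_blocks (b # ys)"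

text \<open>The empty word has one block, of length 0, so the result is never \<open>[]\<close> and
  \<open>hd\<close> and \<open>tl\<close> are safe. The value of \<open>word_of_blocks\<close> at
  \<open>[]\<close> is a dummy; the two maps are inverse on nonempty lists only.\<close>

primrec blocks_of_word :: "bool list \<Rightarrow> nat list" where
  "blocks_of_word [] = [0]"
| "blocks_of_word (b # w) =
     (if b then Suc (hd (blocks_of_word w)) # tl (blocks_of_word w) else 0 # blocks_of_word w)"

text \<open>The argument \<open>z\<close> is the number of failures that precede the word, so that
  suffixes can be weighted too.\<close>

primrec word_weight :: "real \<Rightarrow> real \<Rightarrow> nat \<Rightarrow> bool list \<Rightarrow> real" where
  "word_weight \<theta> q z [] = 1"
| "word_weight \<theta> q z (b # w) =
     (if b then \<theta> * q ^ z * word_weight \<theta> q z w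
      else (1 - \<theta> * q ^ z) * word_weight \<theta> q (Suc z) w)"

lemma blocks_of_word_neq_Nil [simp]: "blocks_of_word w \<noteq> []"
  by (cases w) auto

text \<open>Reconciles the two recursions: \<open>blocks_of_word\<close> consumes letters,
  \<open>word_of_blocks\<close> whole blocks.\<close>

lemma word_of_blocks_Suc: "word_of_blocks (Suc a # ys) = True # word_of_blocks (a # ys)"
  by (cases ys) auto

lemma word_of_blocks_of_word: "word_of_blocks (blocks_of_word w) = w"
proof (induction w)
  case (Cons b w)
  then show ?case
    by (cases "blocks_of_word w") (auto simp: word_of_blocks_Suc)
qed simp

lemma blocks_of_word_replicate:
  "blocks_of_word (replicate a True @ w) = (a + hd (blocks_of_word w)) # tl (blocks_of_word w)"
  by (induction a) auto

lemma blocks_of_word_of_blocks: "y \<noteq> [] \<Longrightarrow> blocks_of_word (word_of_blocks y) = y"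
proof (induction y rule: word_of_blocks.induct)
  case (2 a)
  show ?case using blocks_of_word_replicate[of a "[]"] by simp
qed (auto simp: blocks_of_word_replicate)

lemma length_word_of_blocks: "y \<noteq> [] \<Longrightarrow> Suc (length (word_of_blocks y)) = sum_list y + length y"
  by (induction y rule: word_of_blocks.induct) auto

lemma word_weight_replicate:
  "word_weight \<theta> q z (replicate a True @ w) = (\<theta> * q ^ z) ^ a * word_weight \<theta> q z w"
  by (induction a) auto

text \<open>\<open>word_weight\<close> recurses from the front, but the chain rule in
  \<open>prob_word\<close> extends a history at its end.\<close>

lemma word_weight_append:
  "word_weight \<theta> q z (v @ w) =
     word_weight \<theta> q z v * word_weight \<theta> q (z + count_list v False) w"
  by (induction v arbitrary: z) auto

text \<open>The offset \<open>z\<close> must be arbitrary for the induction, as the zero after the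
  first block raises it by one. At \<open>z = 0\<close> the power of \<open>q\<close> is the summand
  of \<open>Bq\<close>.\<close>

lemma word_weight_word_of_blocks:
  assumes "y \<noteq> []"
  shows "word_weight \<theta> q z (word_of_blocks y) =
    \<theta> ^ sum_list y * (\<Prod>j<length y - 1. 1 - \<theta> * q ^ (z + j)) *
    q ^ (\<Sum>i<length y. (z + i) * y ! i)"
  using assms
proof (induction y arbitrary: z rule: word_of_blocks.induct)
  case (2 a)
  show ?case
    using word_weight_replicate[of \<theta> q z a "[]"] by (simp add: power_mult_distrib power_mult)
next
  case (3 a b ys)
  have "(\<Prod>j<Suc (length ys). 1 - \<theta> * q ^ (z + j)) =
      (1 - \<theta> * q ^ z) * (\<Prod>j<length ys. 1 - \<theta> * q ^ (Suc z + j))"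
    by (subst prod.lessThan_Suc_shift) simp
  moreover have "(\<Sum>i<length (a # b # ys). (z + i) * (a # b # ys) ! i) =
      z * a + (\<Sum>i<length (b # ys). (Suc z + i) * (b # ys) ! i)"
    by (simp only: length_Cons, subst sum.lessThan_Suc_shift) simp
  ultimately show ?case
    using 3
    by (simp add: word_weight_replicate power_add power_mult power_mult_distrib mult.assoc
        del: sum.lessThan_Suc prod.lessThan_Suc)
qed simp

section \<open>Counting runs of exact length by blocks\<close>

lemma exact_success_runs_cong:
  assumes "\<And>j. j \<in> {1..n} \<Longrightarrow> x j = x' j" "1 \<le> k"
  shows "exact_success_runs n k x = exact_success_runs n k x'"
proof -
  have eq: "(\<forall>j\<in>{a..<a + k}. x j = 1) \<longleftrightarrow> (\<forall>j\<in>{a..<a + k}. x' j = 1)"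
    and "a = 1 \<or> x (a - 1) = 0 \<longleftrightarrow> a = 1 \<or> x' (a - 1) = 0"
    and "a + k = n + 1 \<or> x (a + k) = 0 \<longleftrightarrow> a + k = n + 1 \<or> x' (a + k) = 0"
    if "1 \<le> a" "a + k \<le> n + 1" for a
  proof -
    \<comment> \<open>Only positions from 1 to \<open>n\<close> are ever read: the disjuncts
      \<open>a = 1\<close> and \<open>a + k = n + 1\<close> shield positions 0 and
      \<open>n + 1\<close>.\<close>
    have "x j = x' j" if "j \<in> {a..<a + k}" for j
      using that \<open>1 \<le> a\<close> \<open>a + k \<le> n + 1\<close> by (intro assms(1)) auto
    then show "(\<forall>j\<in>{a..<a + k}. x j = 1) \<longleftrightarrow> (\<forall>j\<in>{a..<a + k}. x' j = 1)" by simp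
    show "a = 1 \<or> x (a - 1) = 0 \<longleftrightarrow> a = 1 \<or> x' (a - 1) = 0"
      using assms(1)[of "a - 1"] that assms(2) by (cases "a = 1") fastforce+
    show "a + k = n + 1 \<or> x (a + k) = 0 \<longleftrightarrow> a + k = n + 1 \<or> x' (a + k) = 0"
      using assms(1)[of "a + k"] that by (cases "a + k = n + 1") auto
  qed
  then show ?thesis
    unfolding exact_success_runs_def by (intro arg_cong[where f = card] Collect_cong conj_cong refl eq)
qed

text \<open>With no zero available, a run can be delimited only by the two ends of the
  sequence.\<close>

lemma exact_success_runs_ones:
  assumes "\<And>j. j \<in> {1..n} \<Longrightarrow> x j = 1" "1 \<le> k"
  shows "exact_success_runs n k x = of_bool (n = k)"
proof -
  define S where "S = {a. 1 \<le> a \<and> a + k \<le> n + 1 \<and> (\<forall>j\<in>{a..<a + k}. x j = 1) \<and>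
      (a = 1 \<or> x (a - 1) = 0) \<and> (a + k = n + 1 \<or> x (a + k) = 0)}"
  have "a = 1 \<and> n = k" if "a \<in> S" for a
  proof -
    have "a = 1" using that assms(1)[of "a - 1"] assms(2) by (fastforce simp: S_def)
    moreover have "a + k = n + 1" using that assms(1)[of "a + k"] by (fastforce simp: S_def)
    ultimately show ?thesis by simp
  qed
  moreover have "1 \<in> S" if "n = k" using that assms by (auto simp: S_def)
  ultimately have "S = (if n = k then {1} else {})" by auto
  then show ?thesis unfolding exact_success_runs_def S_def[symmetric] by simp
qed

text \<open>No run crosses the zero at \<open>Suc a\<close>. Before it only the initial block can
  count; after it the zero delimits runs just as the beginning of the shifted sequence does.\<close>

lemma exact_success_runs_first_block:
  assumes ones: "\<And>j. j \<in> {1..a} \<Longrightarrow> x j = 1" and zero: "x (Suc a) = 0" and k: "1 \<le> k"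
  shows "exact_success_runs (a + Suc n) k x =
    of_bool (a = k) + exact_success_runs n k (\<lambda>j. x (Suc a + j))"
proof -
  let ?S = "\<lambda>n x. {a. 1 \<le> a \<and> a + k \<le> n + 1 \<and> (\<forall>j\<in>{a..<a + k}. x j = (1::nat)) \<and>
      (a = 1 \<or> x (a - 1) = 0) \<and> (a + k = n + 1 \<or> x (a + k) = 0)}"
  let ?T = "?S n (\<lambda>j. x (Suc a + j))"
  have fin: "finite ?T" by (rule finite_subset[of _ "{..n + 1}"]) auto
  have shift: "Suc a + p \<in> ?S (a + Suc n) x \<longleftrightarrow> p \<in> ?T" if "1 \<le> p" for p
  proof -
    have "(\<forall>j\<in>{Suc a + p..<Suc a + p + k}. x j = 1) \<longleftrightarrow> (\<forall>j\<in>{p..<p + k}. x (Suc a + j) = 1)"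
    proof -
      have "{Suc a + p..<Suc a + p + k} = (+) (Suc a) ` {p..<p + k}"
        by (simp only: image_add_atLeastLessThan ac_simps)
      then show ?thesis by (simp only: Set.ball_simps(9))
    qed
    \<comment> \<open>At \<open>p = 1\<close> the predecessor is the zero at \<open>Suc a\<close>,
      which matches the boundary disjunct of the shifted sequence.\<close>
    moreover have "x (Suc a + p - 1) = 0 \<longleftrightarrow> p = 1 \<or> x (Suc a + (p - 1)) = 0"
      using that zero by (cases p) auto
    ultimately show ?thesis using that by (auto simp: add.assoc)
  qed
  have first: "p \<in> ?S (a + Suc n) x \<longleftrightarrow> p = 1 \<and> a = k" if "p \<le> Suc a" for p
  proof
    assume p: "p \<in> ?S (a + Suc n) x"
    \<comment> \<open>As \<open>k\<close> is positive, a run contains its own starting position, so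
      it cannot start at the zero.\<close>
    have "x p = 1" using p k by auto
    with zero that have "p \<le> a" by (cases "p = Suc a") auto
    have "p = 1" using p ones[of "p - 1"] \<open>p \<le> a\<close> by fastforce
    have "k \<le> a"
    proof (rule ccontr)
      assume "\<not> k \<le> a"
      then have "Suc a \<in> {p..<p + k}" using \<open>p = 1\<close> by auto
      then have "x (Suc a) = 1" using p by blast
      with zero show False by simp
    qed
    moreover have "\<not> k < a" using p ones[of "p + k"] \<open>p = 1\<close> by auto
    ultimately show "p = 1 \<and> a = k" using \<open>p = 1\<close> by simp
  next
    assume "p = 1 \<and> a = k"
    then show "p \<in> ?S (a + Suc n) x" using ones zero by auto
  qed
  have "?S (a + Suc n) x = (if a = k then {1} else {}) \<union> (+) (Suc a) ` ?T" (is "?L = ?R")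
  proof (rule set_eqI)
    fix p
    show "p \<in> ?L \<longleftrightarrow> p \<in> ?R"
    proof (cases "p \<le> Suc a")
      case True
      then have "p \<notin> (+) (Suc a) ` ?T" by auto
      then show ?thesis using first[OF True] by auto
    next
      case False
      then obtain p' where p': "p = Suc a + p'" "1 \<le> p'"
        by (intro that[of "p - Suc a"]) auto
      have "p \<in> (+) (Suc a) ` ?T \<longleftrightarrow> p' \<in> ?T" unfolding p'(1) by (auto simp: image_iff)
      then show ?thesis using shift[OF p'(2)] p' by auto
    qed
  qed
  moreover have "card ?R = of_bool (a = k) + card ?T"
  proof -
    have "(if a = k then {1} else {}) \<inter> (+) (Suc a) ` ?T = {}" by auto
    then have "card ?R = card (if a = k then {1::nat} else {}) + card ((+) (Suc a) ` ?T)"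
      using fin by (subst card_Un_disjoint) auto
    moreover have "card ((+) (Suc a) ` ?T) = card ?T" by (rule card_image) simp
    ultimately show ?thesis by (cases "a = k") (simp_all only: if_True if_False, simp_all)
  qed
  ultimately show ?thesis by (simp only: exact_success_runs_def)
qed

lemma exact_success_runs_word_of_blocks:
  assumes "y \<noteq> []" "1 \<le> k"
  shows "exact_success_runs (length (word_of_blocks y)) k
      (\<lambda>j. of_bool (word_of_blocks y ! (j - 1))) = count_list y k"
  using assms
proof (induction y rule: word_of_blocks.induct)
  case (2 a)
  then show ?case by (subst exact_success_runs_ones) auto
next
  case (3 a b ys)
  let ?w = "word_of_blocks (b # ys)"
  have "exact_success_runs (a + Suc (length ?w)) k
      (\<lambda>j. of_bool ((replicate a True @ False # ?w) ! (j - 1))) =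
    of_bool (a = k) + exact_success_runs (length ?w) k
      (\<lambda>j. of_bool ((replicate a True @ False # ?w) ! (Suc a + j - 1)))"
    by (rule exact_success_runs_first_block) (use 3 in \<open>auto simp: nth_append\<close>)
  \<comment> \<open>The two sequences may differ at \<open>j = 0\<close>, where one index points to
    the separating zero and the other truncates, so they are equated only on the positions of
    \<open>?w\<close>.\<close>
  also have "exact_success_runs (length ?w) k
      (\<lambda>j. of_bool ((replicate a True @ False # ?w) ! (Suc a + j - 1))) =
    exact_success_runs (length ?w) k (\<lambda>j. of_bool (?w ! (j - 1)))"
    by (rule exact_success_runs_cong) (use 3 in \<open>auto simp: nth_append nth_Cons'\<close>)
  finally show ?case using 3 by simp
qed simp

lemma count_list_eq_card: "count_list y k = card {i. i < length y \<and> y ! i = k}"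
  by (simp add: count_list_eq_length_filter length_filter_conv_card eq_commute)

text \<open>Yields the upper summation limit: \<open>x\<close> blocks of length \<open>k\<close> use
  up \<open>x * k\<close> of the \<open>n\<close> letters.\<close>

lemma count_list_mult_le_sum_list: "count_list y k * k \<le> sum_list (y :: nat list)"
  by (induction y) auto

text \<open>Matches the exponent in \<open>q_sequence\<close> with the one in
  \<open>word_weight_append\<close>.\<close>

lemma count_list_False_eq_sum:
  "count_list w False = (\<Sum>m\<in>{1..<Suc (length w)}. 1 - of_bool (w ! (m - 1)))"
proof (induction w rule: rev_induct)
  case (snoc b w)
  have "(\<Sum>m\<in>{1..<Suc (length w)}. 1 - of_bool ((w @ [b]) ! (m - 1)) :: nat) =
      (\<Sum>m\<in>{1..<Suc (length w)}. 1 - of_bool (w ! (m - 1)))"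
    by (rule sum.cong) (auto simp: nth_append)
  then show ?case using snoc by simp
qed simp

section \<open>From the model to the probability of a word\<close>

lemma q_sequence_sets:
  assumes "q_sequence M X n \<theta> q" "m \<in> {1..n}"
  shows "{\<omega> \<in> space M. X m \<omega> = c} \<in> sets M"
proof -
  have X: "X m \<in> measurable M (count_space {0, 1})"
    using assms by (simp add: q_sequence_def)
  \<comment> \<open>For arbitrary \<open>c\<close>, intersecting with \<open>{0, 1}\<close> gives a
    measurable set of the target space without changing the preimage.\<close>
  have "{\<omega> \<in> space M. X m \<omega> = c} = X m -` ({c} \<inter> {0, 1}) \<inter> space M"
    using measurable_space[OF X] by auto
  also have "\<dots> \<in> sets M" by (rule measurable_sets[OF X]) auto
  finally show ?thesis .
qed

text \<open>This is the chain rule. The induction is at the end of the word because the model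
  conditions each trial on all earlier ones.\<close>

lemma prob_word:
  assumes "q_sequence M X n \<theta> q" "length w \<le> n"
  shows "\<P>(\<omega> in M. \<forall>m\<in>{1..<Suc (length w)}. X m \<omega> = of_bool (w ! (m - 1))) =
    word_weight \<theta> q 0 w"
  using assms(2)
proof (induction w rule: rev_induct)
  case Nil
  interpret prob_space M using assms(1) by (simp add: q_sequence_def)
  show ?case by (simp add: prob_space)
next
  case (snoc b w)
  interpret prob_space M using assms(1) by (simp add: q_sequence_def)
  define j where "j = Suc (length w)"
  define x where "x = (\<lambda>m. of_bool (w ! (m - 1)) :: nat)"
  have j: "j \<in> {1..n}" using snoc.prems by (auto simp: j_def)
  have X: "X m \<in> measurable M (count_space {0, 1})" if "m \<in> {1..n}" for m
    using assms(1) that by (simp add: q_sequence_def)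
  note ev = q_sequence_sets[OF assms(1)]
  define Q where "Q = {\<omega> \<in> space M. \<forall>m\<in>{1..<j}. X m \<omega> = x m}"
  have Q: "Q \<in> events"
    unfolding Q_def using j by (intro sets.sets_Collect_finite_All ev) auto
  have IH: "prob Q = word_weight \<theta> q 0 w"
    using snoc by (simp add: Q_def x_def j_def)
  define A where "A = (\<lambda>c. {\<omega> \<in> space M. X j \<omega> = c} \<inter> Q)"
  have A: "A c \<in> events" for c unfolding A_def using ev[OF j] Q by auto
  have one: "prob (A 1) = \<theta> * q ^ count_list w False * prob Q"
  proof (cases "prob Q = 0")
    \<comment> \<open>The model says nothing about a history of probability 0, but there both sides
      vanish.\<close>
    case True
    have "prob (A 1) \<le> prob Q" by (rule finite_measure_mono) (auto simp: A_def Q)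
    with True show ?thesis by (simp add: measure_le_0_iff)
  next
    case False
    then have "prob Q > 0" by (simp add: zero_less_measure_iff)
    then have "\<P>(\<omega> in M. X j \<omega> = 1 \<bar> \<forall>m\<in>{1..<j}. X m \<omega> = x m) =
        \<theta> * q ^ (\<Sum>m\<in>{1..<j}. 1 - x m)"
      using assms(1) j unfolding q_sequence_def Q_def by blast
    moreover have "{\<omega> \<in> space M. X j \<omega> = 1 \<and> (\<forall>m\<in>{1..<j}. X m \<omega> = x m)} = A 1"
      by (auto simp: A_def Q_def)
    ultimately have "prob (A 1) / prob Q = \<theta> * q ^ (\<Sum>m\<in>{1..<j}. 1 - x m)"
      by (simp only: cond_prob_def Q_def)
    then show ?thesis
      using False by (simp add: field_simps count_list_False_eq_sum x_def j_def)
  qed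
  \<comment> \<open>The model prescribes only the success probability; that of a failure follows by
    complement within the history \<open>Q\<close>.\<close>
  have "Q = A 0 \<union> A 1"
    using measurable_space[OF X[OF j]] by (auto simp: A_def Q_def)
  moreover have "A 0 \<inter> A 1 = {}" by (auto simp: A_def)
  ultimately have "prob Q = prob (A 0) + prob (A 1)"
    using finite_measure_Union[OF A A, of 0 1] by simp
  then have "prob (A (of_bool b)) = word_weight \<theta> q 0 (w @ [b])"
    using one IH by (auto simp: word_weight_append algebra_simps)
  moreover have "{\<omega> \<in> space M. \<forall>m\<in>{1..<Suc (length (w @ [b]))}. X m \<omega> = of_bool ((w @ [b]) ! (m - 1))}
      = A (of_bool b)"
  proof -
    have "{1..<Suc (length (w @ [b]))} = insert j {1..<j}" by (auto simp: j_def)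
    then show ?thesis by (auto simp: A_def Q_def x_def j_def nth_append)
  qed
  ultimately show ?case by simp
qed

lemma finite_words: "finite {w :: bool list. length w = n}"
  using finite_lists_length_eq[of "UNIV :: bool set" n] by simp

text \<open>The event is a finite disjoint union of the events that the trials spell a given word,
  and \<open>prob_word\<close> evaluates each of them.\<close>

lemma prob_exact_success_runs:
  assumes "q_sequence M X n \<theta> q" "1 \<le> k"
  shows "\<P>(\<omega> in M. exact_success_runs n k (\<lambda>j. X j \<omega>) = x) =
    (\<Sum>w | length w = n \<and> exact_success_runs n k (\<lambda>j. of_bool (w ! (j - 1))) = x.
       word_weight \<theta> q 0 w)"
proof -
  interpret prob_space M using assms(1) by (simp add: q_sequence_def)
  define W where
    "W = {w. length w = n \<and> exact_success_runs n k (\<lambda>j. of_bool (w ! (j - 1))) = x}"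
  define C where
    "C = (\<lambda>w. {\<omega> \<in> space M. \<forall>m\<in>{1..<Suc (length w)}. X m \<omega> = of_bool (w ! (m - 1))})"
  have X: "X m \<in> measurable M (count_space {0, 1})" if "m \<in> {1..n}" for m
    using assms(1) that by (simp add: q_sequence_def)
  note ev = q_sequence_sets[OF assms(1)]
  have C: "C w \<in> events" if "w \<in> W" for w
    unfolding C_def using that
    by (intro sets.sets_Collect_finite_All ev) (auto simp: W_def)
  have fin: "finite W" by (rule finite_subset[OF _ finite_words[of n]]) (auto simp: W_def)
  have disj: "disjoint_family_on C W"
  proof (unfold disjoint_family_on_def, intro ballI impI)
    fix v w assume vw: "v \<in> W" "w \<in> W" "v \<noteq> w"
    then obtain i where i: "i < n" "v ! i \<noteq> w ! i" by (auto simp: W_def list_eq_iff_nth_eq)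
    have "X (Suc i) \<omega> = of_bool (u ! i)" if "\<omega> \<in> C u" "u \<in> W" for \<omega> u
    proof -
      have "Suc i \<in> {1..<Suc (length u)}" using i that(2) by (simp add: W_def)
      then have "X (Suc i) \<omega> = of_bool (u ! (Suc i - 1))"
        using that(1) unfolding C_def by blast
      then show ?thesis by simp
    qed
    then show "C v \<inter> C w = {}" using i vw by (metis disjoint_iff of_bool_eq_iff)
  qed
  have "{\<omega> \<in> space M. exact_success_runs n k (\<lambda>j. X j \<omega>) = x} = (\<Union>w\<in>W. C w)"
  proof (rule set_eqI, rule iffI)
    fix \<omega> assume \<omega>: "\<omega> \<in> {\<omega> \<in> space M. exact_success_runs n k (\<lambda>j. X j \<omega>) = x}"
    \<comment> \<open>The word spelled by the outcome. List index \<open>i\<close> belongs to trial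
      \<open>Suc i\<close>, and testing for 1 loses nothing since the trials are binary.\<close>
    define w where "w = map (\<lambda>i. X (Suc i) \<omega> = 1) [0..<n]"
    have w: "X m \<omega> = of_bool (w ! (m - 1))" if "m \<in> {1..n}" for m
      using measurable_space[OF X[OF that], of \<omega>] \<omega> that by (auto simp: w_def)
    have "exact_success_runs n k (\<lambda>j. of_bool (w ! (j - 1))) = exact_success_runs n k (\<lambda>j. X j \<omega>)"
      by (rule exact_success_runs_cong) (use w assms in auto)
    then have "w \<in> W" using \<omega> by (simp add: W_def w_def)
    moreover have "\<omega> \<in> C w" using \<omega> w by (auto simp: C_def w_def)
    ultimately show "\<omega> \<in> (\<Union>w\<in>W. C w)" by blast
  next
    fix \<omega> assume "\<omega> \<in> (\<Union>w\<in>W. C w)"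
    then obtain w where w: "w \<in> W" "\<omega> \<in> C w" by blast
    have "exact_success_runs n k (\<lambda>j. X j \<omega>) = exact_success_runs n k (\<lambda>j. of_bool (w ! (j - 1)))"
      by (rule exact_success_runs_cong) (use w assms in \<open>auto simp: C_def W_def\<close>)
    then show "\<omega> \<in> {\<omega> \<in> space M. exact_success_runs n k (\<lambda>j. X j \<omega>) = x}"
      using w by (simp add: W_def C_def)
  qed
  then have "\<P>(\<omega> in M. exact_success_runs n k (\<lambda>j. X j \<omega>) = x) = (\<Sum>w\<in>W. prob (C w))"
    using finite_measure_finite_Union[OF fin _ disj] C by auto
  also have "\<dots> = (\<Sum>w\<in>W. word_weight \<theta> q 0 w)"
    unfolding C_def by (intro sum.cong prob_word[OF assms(1)]) (auto simp: W_def)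
  finally show ?thesis by (simp add: W_def)
qed

section \<open>Summation over block lists, grouped by the number of zeros\<close>

theorem theorem3p1:
  fixes M :: "'a measure" and X :: "nat \<Rightarrow> 'a \<Rightarrow> nat"
    and \<theta> q :: real and n k x :: nat
  assumes "0 < q" "q \<le> 1" "0 \<le> \<theta>" "\<theta> \<le> 1"
    and "1 \<le> k" "k \<le> n"
    and "q_sequence M X n \<theta> q"
  shows "\<P>(\<omega> in M. exact_success_runs n k (\<lambda>j. X j \<omega>) = x) =
    (\<Sum>i | int i \<le> int n - int x * int k.
       \<theta> ^ (n - i) * (\<Prod>j\<in>{1..i}. 1 - \<theta> * q ^ (j - 1)) *
       Bq q (i + 1) (int n - int i) (int x) k)"
proof -
  \<comment> \<open>The bound is compared in the integers: for \<open>x * k > n\<close> this set is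
    empty, whereas truncated subtraction would leave the index 0.\<close>
  let ?I = "{i. int i \<le> int n - int x * int k}"
  define W where
    "W = {w. length w = n \<and> exact_success_runs n k (\<lambda>j. of_bool (w ! (j - 1))) = x}"
  \<comment> \<open>A word with \<open>i\<close> zeros has \<open>n - i\<close> ones and
    \<open>i + 1\<close> blocks, so the total \<open>Suc n\<close> does not depend on
    \<open>i\<close>.\<close>
  define Y where
    "Y = {y :: nat list. y \<noteq> [] \<and> sum_list y + length y = Suc n \<and> count_list y k = x}"
  define f where
    "f = (\<lambda>y. \<theta> ^ sum_list y * (\<Prod>j<length y - 1. 1 - \<theta> * q ^ j) * q ^ (\<Sum>i<length y. i * y ! i))"
  have WY: "word_of_blocks y \<in> W" if "y \<in> Y" for y
    using that length_word_of_blocks[of y] exact_success_runs_word_of_blocks[of y k] assms(5)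
    by (auto simp: W_def Y_def)
  have YW: "blocks_of_word w \<in> Y" if "w \<in> W" for w
    using that length_word_of_blocks[of "blocks_of_word w"] assms(5)
      exact_success_runs_word_of_blocks[of "blocks_of_word w" k]
    by (auto simp: W_def Y_def word_of_blocks_of_word)
  have finW: "finite W" by (rule finite_subset[OF _ finite_words[of n]]) (auto simp: W_def)
  have "Y \<subseteq> blocks_of_word ` W"
  proof
    fix y assume "y \<in> Y"
    then show "y \<in> blocks_of_word ` W"
      using WY[of y] blocks_of_word_of_blocks[of y] by (metis (mono_tags, lifting) Y_def imageI mem_Collect_eq)
  qed
  then have finY: "finite Y" using finW by (rule finite_surj[rotated])
  have le_n: "i \<le> n" if "i \<in> ?I" for i
  proof -
    have "int (i + x * k) \<le> int n" using that by simp
    then show ?thesis by (simp only: of_nat_le_iff)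
  qed
  have finI: "finite ?I" by (rule finite_subset[of _ "{..n}"]) (use le_n in auto)
  have le: "int (length y - 1) \<le> int n - int x * int k" if "y \<in> Y" for y
  proof -
    have "x * k \<le> sum_list y" using count_list_mult_le_sum_list[of y k] that by (simp add: Y_def)
    then have "length y - 1 + x * k \<le> n" using that by (cases y) (auto simp: Y_def)
    then show ?thesis by (simp add: le_diff_eq flip: of_nat_mult of_nat_add)
  qed
  have "\<P>(\<omega> in M. exact_success_runs n k (\<lambda>j. X j \<omega>) = x) = (\<Sum>w\<in>W. word_weight \<theta> q 0 w)"
    unfolding W_def by (rule prob_exact_success_runs) fact+
  also have "\<dots> = (\<Sum>y\<in>Y. f y)"
  proof (rule sum.reindex_bij_witness[of _ word_of_blocks blocks_of_word])
    fix w assume "w \<in> W"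
    show "f (blocks_of_word w) = word_weight \<theta> q 0 w"
      using word_weight_word_of_blocks[of "blocks_of_word w" \<theta> q 0]
      by (simp add: f_def word_of_blocks_of_word)
  qed (use WY YW in \<open>auto simp: word_of_blocks_of_word blocks_of_word_of_blocks Y_def\<close>)
  \<comment> \<open>The number of zeros is \<open>length y - 1\<close>; by \<open>le\<close>, every
    list in \<open>Y\<close> falls into a class indexed by \<open>?I\<close>.\<close>
  also have "\<dots> = (\<Sum>i\<in>?I. \<Sum>y\<in>{y \<in> Y. length y - 1 = i}. f y)"
    by (rule sum.group[symmetric]) (use finY finI le in auto)
  also have "\<dots> = (\<Sum>i\<in>?I. \<theta> ^ (n - i) * (\<Prod>j\<in>{1..i}. 1 - \<theta> * q ^ (j - 1)) *
       Bq q (i + 1) (int n - int i) (int x) k)"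
  proof (rule sum.cong)
    fix i assume i: "i \<in> ?I"
    then have "i \<le> n" by (rule le_n)
    \<comment> \<open>Each class is exactly the range of summation in \<open>Bq\<close>, and on it
      \<open>f\<close> depends on \<open>y\<close> only through the power of
      \<open>q\<close>.\<close>
    have eq: "{y \<in> Y. length y - 1 = i} = {y. length y = i + 1 \<and> int (sum_list y) = int n - int i \<and>
        int (card {j. j < i + 1 \<and> y ! j = k}) = int x}"
    proof -
      have "y \<in> Y \<and> length y - 1 = i \<longleftrightarrow>
          length y = i + 1 \<and> sum_list y + i = n \<and> card {j. j < i + 1 \<and> y ! j = k} = x" for y
        by (cases y) (auto simp: Y_def count_list_eq_card)
      moreover have "int (sum_list y) = int n - int i \<longleftrightarrow> sum_list y + i = n" for y
        by linarith
      ultimately show ?thesis by auto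
    qed
    have prod: "(\<Prod>j<i. 1 - \<theta> * q ^ j) = (\<Prod>j\<in>{1..i}. 1 - \<theta> * q ^ (j - 1))"
      by (rule prod.reindex_bij_witness[of _ "\<lambda>j. j - 1" Suc]) auto
    have "f y = \<theta> ^ (n - i) * (\<Prod>j\<in>{1..i}. 1 - \<theta> * q ^ (j - 1)) * q ^ (\<Sum>j<i + 1. j * y ! j)"
      if "y \<in> {y \<in> Y. length y - 1 = i}" for y
    proof -
      have "length y = i + 1" "int (sum_list y) = int n - int i" using that unfolding eq by auto
      then have "length y = i + 1" "sum_list y = n - i" by linarith+
      then show ?thesis using prod by (simp add: f_def)
    qed
    then show "(\<Sum>y\<in>{y \<in> Y. length y - 1 = i}. f y) =
        \<theta> ^ (n - i) * (\<Prod>j\<in>{1..i}. 1 - \<theta> * q ^ (j - 1)) * Bq q (i + 1) (int n - int i) (int x) k"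
      unfolding Bq_def sum_distrib_left eq by (intro sum.cong) auto
  qed simp
  finally show ?thesis .
qed

end
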